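(* Let $\alpha:I\to\mathbb{R}^3$ be a nonplanar arclength parametrized curve with curvature $\kappa_\alpha>0$ and torsion $\tau_\alpha$, let $a,b,c$ be real constants with $a^2+b^2+c^2=1$, and let $V\in\mathbb{R}^3$ be a constant unit vector. Then $\alpha$ is a helix associated to the unit $F$-constant vector field $W=aT_\alpha+bN_\alpha+cB_\alpha$ orthogonal to the axis $V$ (that is, $\langle W(s),V\rangle=0$ for all $s\in I$) if and only if $\alpha$ is contained in a cylinder $C_{\beta,V}$ and satisfies $$a\tan\varphi+b\sin\theta-c\cos\theta=0$$ on $I$ (in particular $\cos\varphi$ is nowhere zero), where the angle functions $\varphi$ and $\theta$ along $\alpha$ are given by $$\sin\varphi=\langle T_\alpha,V\rangle,\qquad \sin\theta\,\langle B_\alpha,V\rangle+\cos\theta\,\langle N_\alpha,V\rangle=0,$$ with signs chosen so that $V=\sin\varphi\,T_\alpha+\cos\varphi\,(\sin\theta\,N_\alpha-\cos\theta\,B_\alpha)$.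
   Context: $I$ is an open interval and all curves and functions are smooth ($C^\infty$). For an arclength parametrized curve $\alpha:I\to\mathbb{R}^3$ with $\kappa_\alpha>0$, the Frenet frame $\{T_\alpha,N_\alpha,B_\alpha\}$ satisfies $T_\alpha'=\kappa_\alpha N_\alpha$, $N_\alpha'=-\kappa_\alpha T_\alpha+\tau_\alpha B_\alpha$, $B_\alpha'=-\tau_\alpha N_\alpha$. "Nonplanar" means that $\alpha$ is not contained in a plane (the torsion is not identically zero). A vector field $W$ along $\alpha$ is called $F$-constant (with respect to the Frenet frame) if $W'=D_\alpha\times W$, where $D_\alpha=\tau_\alpha T_\alpha+\kappa_\alpha B_\alpha$ is the Darboux vector; equivalently, $W=aT_\alpha+bN_\alpha+cB_\alpha$ with real constants $a,b,c$. A curve $\alpha$ is a helix if there is an $F$-constant vector field $W$ along $\alpha$ forming a constant angle with a fixed direction $V$, called an axis of the helix. The cylinder $C_{\beta,V}$ is the (possibly self-intersecting) surface parametrized by $X(t,z)=\beta(t)+zV$, where $\beta$ is a unit speed curve in a plane orthogonal to the unit vector $V$. That $\alpha$ is contained in $C_{\beta,V}$ means $\alpha(s)=X(t(s),z(s))$ for smooth functions $t,z$ on $I$. The angles $\varphi,\theta$ are smooth functions on $I$ which are in general not constant. *)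

theory Defs
  imports "HOL-Analysis.Analysis"
begin

(* Class C-infinity on an open set I of parameters. The iterated derivatives are two-sided,
   so at a point of the open set I they depend only on f near that point. *)
definition smooth_on :: "real set \<Rightarrow> (real \<Rightarrow> 'a::real_normed_vector) \<Rightarrow> bool" where
  "smooth_on I f \<longleftrightarrow>
     (\<forall>n. \<forall>s\<in>I. (((\<lambda>g u. vector_derivative g (at u)) ^^ n) f) differentiable (at s))"

definition unit_speed_curve :: "real set \<Rightarrow> (real \<Rightarrow> real^3) \<Rightarrow> bool" where
  "unit_speed_curve I \<alpha> \<longleftrightarrow>
     smooth_on I \<alpha> \<and> (\<forall>s\<in>I. norm (vector_derivative \<alpha> (at s)) = 1)"

(* The Frenet apparatus; meaningful for unit speed curves with positive curvature. *)

definition tangent :: "(real \<Rightarrow> real^3) \<Rightarrow> real \<Rightarrow> real^3" where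
  "tangent \<alpha> s = vector_derivative \<alpha> (at s)"

definition curvature :: "(real \<Rightarrow> real^3) \<Rightarrow> real \<Rightarrow> real" where
  "curvature \<alpha> s = norm (vector_derivative (tangent \<alpha>) (at s))"

definition principal_normal :: "(real \<Rightarrow> real^3) \<Rightarrow> real \<Rightarrow> real^3" where
  "principal_normal \<alpha> s = vector_derivative (tangent \<alpha>) (at s) /\<^sub>R curvature \<alpha> s"

definition binormal :: "(real \<Rightarrow> real^3) \<Rightarrow> real \<Rightarrow> real^3" where
  "binormal \<alpha> s = cross3 (tangent \<alpha> s) (principal_normal \<alpha> s)"

(* The sign is the one for which B' = - tau N. *)
definition torsion :: "(real \<Rightarrow> real^3) \<Rightarrow> real \<Rightarrow> real" where
  "torsion \<alpha> s = - (vector_derivative (binormal \<alpha>) (at s) \<bullet> principal_normal \<alpha> s)"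

definition darboux :: "(real \<Rightarrow> real^3) \<Rightarrow> real \<Rightarrow> real^3" where
  "darboux \<alpha> s = torsion \<alpha> s *\<^sub>R tangent \<alpha> s + curvature \<alpha> s *\<^sub>R binormal \<alpha> s"

definition F_constant :: "real set \<Rightarrow> (real \<Rightarrow> real^3) \<Rightarrow> (real \<Rightarrow> real^3) \<Rightarrow> bool" where
  "F_constant I \<alpha> W \<longleftrightarrow>
     smooth_on I W \<and>
     (\<forall>s\<in>I. (W has_vector_derivative cross3 (darboux \<alpha> s) (W s)) (at s))"

definition vec_angle :: "real^3 \<Rightarrow> real^3 \<Rightarrow> real" where
  "vec_angle u v = arccos ((u \<bullet> v) / (norm u * norm v))"

(* The curve alpha is a helix by virtue of the field W, with axis V. The nonvanishing
   conditions make the angle between W and V meaningful. *)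
definition helix_associated ::
    "real set \<Rightarrow> (real \<Rightarrow> real^3) \<Rightarrow> (real \<Rightarrow> real^3) \<Rightarrow> real^3 \<Rightarrow> bool" where
  "helix_associated I \<alpha> W V \<longleftrightarrow>
     F_constant I \<alpha> W \<and> V \<noteq> 0 \<and> (\<forall>s\<in>I. W s \<noteq> 0) \<and>
     (\<exists>\<omega>. \<forall>s\<in>I. vec_angle (W s) V = \<omega>)"

definition cylinder_param :: "(real \<Rightarrow> real^3) \<Rightarrow> real^3 \<Rightarrow> real \<Rightarrow> real \<Rightarrow> real^3" where
  "cylinder_param \<beta> V t z = \<beta> t + z *\<^sub>R V"

(* The base curve beta has an open parameter interval J of its own. *)
definition cylinder_base :: "real set \<Rightarrow> (real \<Rightarrow> real^3) \<Rightarrow> real^3 \<Rightarrow> bool" where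
  "cylinder_base J \<beta> V \<longleftrightarrow>
     open J \<and> is_interval J \<and> unit_speed_curve J \<beta> \<and> (\<exists>d. \<forall>u\<in>J. \<beta> u \<bullet> V = d)"

definition contained_in_cylinder ::
    "real set \<Rightarrow> (real \<Rightarrow> real^3) \<Rightarrow> real set \<Rightarrow> (real \<Rightarrow> real^3) \<Rightarrow> real^3 \<Rightarrow> bool" where
  "contained_in_cylinder I \<alpha> J \<beta> V \<longleftrightarrow>
     (\<exists>t z. smooth_on I t \<and> smooth_on I z \<and>
        (\<forall>s\<in>I. t s \<in> J \<and> \<alpha> s = cylinder_param \<beta> V (t s) (z s)))"

definition angle_functions ::
    "real set \<Rightarrow> (real \<Rightarrow> real^3) \<Rightarrow> real^3 \<Rightarrow> (real \<Rightarrow> real) \<Rightarrow> (real \<Rightarrow> real) \<Rightarrow> bool" where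
  "angle_functions I \<alpha> V \<phi> \<theta> \<longleftrightarrow>
     smooth_on I \<phi> \<and> smooth_on I \<theta> \<and>
     (\<forall>s\<in>I. sin (\<phi> s) = tangent \<alpha> s \<bullet> V \<and>
        sin (\<theta> s) * (binormal \<alpha> s \<bullet> V) + cos (\<theta> s) * (principal_normal \<alpha> s \<bullet> V) = 0 \<and>
        V = sin (\<phi> s) *\<^sub>R tangent \<alpha> s +
            cos (\<phi> s) *\<^sub>R (sin (\<theta> s) *\<^sub>R principal_normal \<alpha> s - cos (\<theta> s) *\<^sub>R binormal \<alpha> s))"

end

theory Submission
  imports Defs
begin

text \<open>
  Write \<open>V\<close> in the Frenet frame of \<open>\<alpha>\<close>. If \<open>T\<close> is nowhere parallel to \<open>V\<close>, then \<open>\<langle>T, V\<rangle>\<close> lies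
  strictly between \<open>-1\<close> and \<open>1\<close>, so \<open>\<phi> = arcsin \<langle>T, V\<rangle>\<close> is smooth with \<open>cos \<phi> > 0\<close>, and the
  normalized remaining coordinates \<open>(\<langle>N, V\<rangle>, - \<langle>B, V\<rangle>) / cos \<phi>\<close> trace a smooth curve on the unit
  circle, which has a smooth angle \<open>\<theta>\<close> because the parameter interval is simply connected. With these
  angles \<open>\<langle>W, V\<rangle> = cos \<phi> (a tan \<phi> + b sin \<theta> - c cos \<theta>)\<close> (lemma \<open>F_constant_inner_axis\<close>), so the
  orthogonality of \<open>W\<close> and \<open>V\<close> is exactly the equation on the angles. The same transversality makes
  the orthogonal projection of \<open>\<alpha>\<close> along \<open>V\<close> a regular curve; its arclength reparametrization is the
  base curve of a cylinder that contains \<open>\<alpha>\<close>.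

  What remains is to see that \<open>\<langle>W, V\<rangle> = 0\<close> forces transversality (lemma \<open>axis_nowhere_tangent\<close>); this is
  where the curve has to be nonplanar. If \<open>T = \<plusminus>V\<close> at a point, then the relation
  \<open>a \<langle>T, V\<rangle> + b \<langle>N, V\<rangle> + c \<langle>B, V\<rangle> = 0\<close> gives \<open>a = 0\<close> there, and its derivative gives \<open>b = 0\<close>. Hence
  \<open>\<langle>B, V\<rangle>\<close> vanishes identically, and differentiating, \<open>\<tau> \<langle>N, V\<rangle> = 0\<close>. Near a point with \<open>\<tau> \<noteq> 0\<close> this
  would make \<open>\<langle>N, V\<rangle>\<close> vanish, then also its derivative \<open>- \<kappa> \<langle>T, V\<rangle>\<close>, so all coordinates of \<open>V\<close>
  would be zero. Therefore \<open>\<tau>\<close> is identically zero and \<open>\<alpha>\<close> is planar.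

  Conversely, every field with constant coefficients in the Frenet frame is \<open>F\<close>-constant, so only the
  formula for \<open>\<langle>W, V\<rangle>\<close> is needed.
\<close>

section \<open>Smooth functions of a real variable\<close>

text \<open>
  Closure properties of \<^const>\<open>smooth_on\<close> need inductions in which a derivative is only known on \<open>I\<close>
  and by a formula. Asking for some successive derivatives, rather than for the canonical ones
  that iterate \<^const>\<open>vector_derivative\<close>, lets the induction step supply that formula.
\<close>

primrec times_differentiable_on ::
    "nat \<Rightarrow> real set \<Rightarrow> (real \<Rightarrow> 'a::real_normed_vector) \<Rightarrow> bool" where
  "times_differentiable_on 0 I f \<longleftrightarrow> True"
| "times_differentiable_on (Suc n) I f \<longleftrightarrow>
     (\<exists>f'. (\<forall>s\<in>I. (f has_vector_derivative f' s) (at s)) \<and> times_differentiable_on n I f')"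

lemma times_differentiable_on_SucD:
  "times_differentiable_on (Suc n) I f \<Longrightarrow> times_differentiable_on n I f"
  by (induction n arbitrary: f) (simp, metis times_differentiable_on.simps(2))

lemma times_differentiable_on_cong:
  assumes "open I" "\<And>s. s \<in> I \<Longrightarrow> f s = g s" "times_differentiable_on n I f"
  shows "times_differentiable_on n I g"
proof (cases n)
  case (Suc m)
  then obtain f' where "\<forall>s\<in>I. (f has_vector_derivative f' s) (at s)"
    and "times_differentiable_on m I f'"
    using assms(3) by auto
  moreover from this have "\<forall>s\<in>I. (g has_vector_derivative f' s) (at s)"
    using assms(1,2) by (blast intro: has_vector_derivative_transform_within_open)
  ultimately show ?thesis
    unfolding Suc by auto
qed simp

lemma smooth_on_derivative:
  "smooth_on I f \<Longrightarrow> smooth_on I (\<lambda>s. vector_derivative f (at s))"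
  unfolding smooth_on_def
proof (intro allI)
  fix n
  assume a: "\<forall>n. \<forall>s\<in>I. (((\<lambda>g u. vector_derivative g (at u)) ^^ n) f) differentiable (at s)"
  show "\<forall>s\<in>I. (((\<lambda>g u. vector_derivative g (at u)) ^^ n) (\<lambda>s. vector_derivative f (at s)))
      differentiable (at s)"
    using a[rule_format, of _ "Suc n"] unfolding funpow_Suc_right o_apply by blast
qed

lemma smooth_on_has_derivative:
  "smooth_on I f \<Longrightarrow> s \<in> I \<Longrightarrow> (f has_vector_derivative vector_derivative f (at s)) (at s)"
  unfolding smooth_on_def vector_derivative_works[symmetric]
  by (metis funpow_0)

text \<open>
  On an open set derivatives are unique and local, so any chain of successive derivatives agrees
  with the canonical one.
\<close>

lemma smooth_on_iff_times_differentiable_on: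
  assumes "open I"
  shows "smooth_on I f \<longleftrightarrow> (\<forall>n. times_differentiable_on n I f)"
proof (intro iffI allI)
  fix n
  assume "smooth_on I f"
  then show "times_differentiable_on n I f"
  proof (induction n arbitrary: f)
    case (Suc n)
    then show ?case
      unfolding times_differentiable_on.simps
      by (intro exI[of _ "\<lambda>s. vector_derivative f (at s)"] conjI ballI
          smooth_on_has_derivative Suc.IH smooth_on_derivative)
  qed simp
next
  assume all: "\<forall>n. times_differentiable_on n I f"
  let ?D = "\<lambda>g u. vector_derivative g (at u) :: 'a"
  have step: "times_differentiable_on n I (?D g)" if "times_differentiable_on (Suc n) I g" for g n
  proof -
    obtain g' where g': "\<forall>s\<in>I. (g has_vector_derivative g' s) (at s)"
      and n: "times_differentiable_on n I g'"
      using \<open>times_differentiable_on (Suc n) I g\<close> by auto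
    have "g' s = ?D g s" if "s \<in> I" for s
      using vector_derivative_at[OF g'[rule_format, OF that]] by (rule sym)
    then show ?thesis
      by (rule times_differentiable_on_cong[OF assms _ n])
  qed
  have "times_differentiable_on n I ((?D ^^ k) f)" for n k
    using all by (induction k arbitrary: n) (auto intro: step)
  then have "times_differentiable_on (Suc 0) I ((?D ^^ k) f)" for k
    by blast
  then show "smooth_on I f"
    unfolding smooth_on_def by (force intro: differentiableI_vector)
qed

lemma smooth_onI:
  assumes "open I" "\<And>s. s \<in> I \<Longrightarrow> (f has_vector_derivative f' s) (at s)" "smooth_on I f'"
  shows "smooth_on I f"
proof -
  have "times_differentiable_on n I f" for n
    using assms by (cases n) (auto simp: smooth_on_iff_times_differentiable_on)
  then show ?thesis
    using assms(1) by (simp add: smooth_on_iff_times_differentiable_on)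
qed

lemma smooth_on_continuous_on: "smooth_on I f \<Longrightarrow> continuous_on I f"
  by (meson continuous_at_imp_continuous_on has_vector_derivative_continuous
      smooth_on_has_derivative)

lemma times_differentiable_on_const: "times_differentiable_on n I (\<lambda>s. c)"
  by (induction n arbitrary: c) (auto intro!: exI[of _ "\<lambda>s. 0"])

lemma times_differentiable_on_add:
  "times_differentiable_on n I f \<Longrightarrow> times_differentiable_on n I g \<Longrightarrow>
     times_differentiable_on n I (\<lambda>s. f s + g s)"
proof (induction n arbitrary: f g)
  case (Suc n)
  then obtain f' g' where "\<forall>s\<in>I. (f has_vector_derivative f' s) (at s)"
      "\<forall>s\<in>I. (g has_vector_derivative g' s) (at s)"
      "times_differentiable_on n I f'" "times_differentiable_on n I g'"
    by auto
  then show ?case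
    using Suc.IH[of f' g'] by (auto intro!: exI[of _ "\<lambda>s. f' s + g' s"] derivative_intros)
qed simp

text \<open>
  One product rule serves scalar multiples, products, inner products and cross products.
\<close>

lemma times_differentiable_on_bilinear:
  assumes "bounded_bilinear B"
  shows "times_differentiable_on n I f \<Longrightarrow> times_differentiable_on n I g \<Longrightarrow>
     times_differentiable_on n I (\<lambda>s. B (f s) (g s))"
proof (induction n arbitrary: f g)
  case (Suc n)
  then obtain f' g' where "\<forall>s\<in>I. (f has_vector_derivative f' s) (at s)"
      "\<forall>s\<in>I. (g has_vector_derivative g' s) (at s)"
    and n: "times_differentiable_on n I f'" "times_differentiable_on n I g'"
    by auto
  then have "\<forall>s\<in>I. ((\<lambda>s. B (f s) (g s)) has_vector_derivative
      B (f s) (g' s) + B (f' s) (g s)) (at s)"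
    by (auto intro: bounded_bilinear.has_vector_derivative[OF assms])
  moreover have "times_differentiable_on n I (\<lambda>s. B (f s) (g' s) + B (f' s) (g s))"
    using Suc.prems[THEN times_differentiable_on_SucD] n
    by (intro times_differentiable_on_add Suc.IH)
  ultimately show ?case
    unfolding times_differentiable_on.simps by fast
qed simp

lemma times_differentiable_on_compose:
  assumes "\<And>s. s \<in> I \<Longrightarrow> g s \<in> J"
  shows "times_differentiable_on n J f \<Longrightarrow> times_differentiable_on n I g \<Longrightarrow>
     times_differentiable_on n I (\<lambda>s. f (g s))"
proof (induction n arbitrary: f)
  case (Suc n)
  then obtain f' g' where d: "\<forall>s\<in>J. (f has_vector_derivative f' s) (at s)"
      "\<forall>s\<in>I. (g has_vector_derivative g' s) (at s)"
    and n: "times_differentiable_on n J f'" "times_differentiable_on n I g'"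
    by auto
  have "\<forall>s\<in>I. ((\<lambda>s. f (g s)) has_vector_derivative g' s *\<^sub>R f' (g s)) (at s)"
    using vector_diff_chain_at d assms unfolding o_def by blast
  moreover have "times_differentiable_on n I (\<lambda>s. g' s *\<^sub>R f' (g s))"
    using Suc.prems(2)[THEN times_differentiable_on_SucD] n
    by (intro times_differentiable_on_bilinear[OF bounded_bilinear_scaleR] Suc.IH)
  ultimately show ?case
    unfolding times_differentiable_on.simps by fast
qed simp

lemma smooth_on_const: "open I \<Longrightarrow> smooth_on I (\<lambda>s. c)"
  by (simp add: smooth_on_iff_times_differentiable_on times_differentiable_on_const)

lemma smooth_on_id: "open I \<Longrightarrow> smooth_on I (\<lambda>s. s)"
  by (rule smooth_onI[where f' = "\<lambda>_. 1"]) (auto intro: smooth_on_const)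

lemma smooth_on_add:
  "open I \<Longrightarrow> smooth_on I f \<Longrightarrow> smooth_on I g \<Longrightarrow> smooth_on I (\<lambda>s. f s + g s)"
  by (simp add: smooth_on_iff_times_differentiable_on times_differentiable_on_add)

lemma smooth_on_bilinear:
  "bounded_bilinear B \<Longrightarrow> open I \<Longrightarrow> smooth_on I f \<Longrightarrow> smooth_on I g \<Longrightarrow>
     smooth_on I (\<lambda>s. B (f s) (g s))"
  by (simp add: smooth_on_iff_times_differentiable_on times_differentiable_on_bilinear)

lemma smooth_on_compose:
  assumes "open I" "open J" "smooth_on J f" "smooth_on I g" "\<And>s. s \<in> I \<Longrightarrow> g s \<in> J"
  shows "smooth_on I (\<lambda>s. f (g s))"
  using assms times_differentiable_on_compose[of I g J _ f]
  by (simp add: smooth_on_iff_times_differentiable_on)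

lemmas smooth_on_scaleR = smooth_on_bilinear[OF bounded_bilinear_scaleR]
lemmas smooth_on_mult = smooth_on_bilinear[OF bounded_bilinear_mult]
lemmas smooth_on_inner = smooth_on_bilinear[OF bounded_bilinear_inner]

lemma bounded_bilinear_cross3: "bounded_bilinear cross3"
  unfolding bilinear_conv_bounded_bilinear[symmetric] bilinear_def
  by (auto intro!: linearI simp: cross_add_left cross_add_right cross_mult_left cross_mult_right)

lemmas smooth_on_cross3 = smooth_on_bilinear[OF bounded_bilinear_cross3]

lemma smooth_on_minus:
  assumes "open I" "smooth_on I f"
  shows "smooth_on I (\<lambda>s. - f s)"
  using smooth_on_scaleR[OF assms(1) smooth_on_const[OF assms(1), of "-1"] assms(2)] by simp

lemma smooth_on_diff:
  assumes "open I" "smooth_on I f" "smooth_on I g"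
  shows "smooth_on I (\<lambda>s. f s - g s)"
  using smooth_on_add[OF assms(1,2) smooth_on_minus[OF assms(1,3)]] by simp

text \<open>
  The three functions below are smooth because their derivatives are built from functions already
  known to be smooth and from the function itself: \<open>-1/x\<^sup>2\<close> for the reciprocal, \<open>1/(2 sqrt x)\<close>
  for the square root and \<open>1/sqrt (1 - x\<^sup>2)\<close> for the arcsine.
\<close>

lemma smooth_on_inverse:
  assumes "open I" "smooth_on I f" "\<And>s. s \<in> I \<Longrightarrow> f s \<noteq> (0::real)"
  shows "smooth_on I (\<lambda>s. inverse (f s))"
proof (rule smooth_on_compose[OF assms(1) _ _ assms(2), where J = "- {0}"])
  have "times_differentiable_on n (- {0}) (inverse :: real \<Rightarrow> real)" for n
  proof (induction n)
    case (Suc n)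
    have "\<forall>s\<in>- {0}. ((inverse :: real \<Rightarrow> real) has_vector_derivative
        - 1 * (inverse s * inverse s)) (at s)"
      unfolding has_real_derivative_iff_has_vector_derivative[symmetric]
      by (auto intro!: derivative_eq_intros)
    moreover have "times_differentiable_on n (- {0}) (\<lambda>s::real. - 1 * (inverse s * inverse s))"
      by (intro times_differentiable_on_bilinear[OF bounded_bilinear_mult]
          times_differentiable_on_const Suc)
    ultimately show ?case
      unfolding times_differentiable_on.simps by fast
  qed simp
  then show "smooth_on (- {0}) (inverse :: real \<Rightarrow> real)"
    by (simp add: smooth_on_iff_times_differentiable_on open_Compl)
qed (use assms in auto)

lemma smooth_on_sqrt:
  assumes "open I" "smooth_on I f" "\<And>s. s \<in> I \<Longrightarrow> f s > (0::real)"
  shows "smooth_on I (\<lambda>s. sqrt (f s))"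
proof (rule smooth_on_compose[OF assms(1) _ _ assms(2), where J = "{0<..}"])
  have inv: "smooth_on (- {0}) (inverse :: real \<Rightarrow> real)"
    by (rule smooth_on_inverse) (auto simp: open_Compl intro: smooth_on_id)
  have "times_differentiable_on n {0<..} sqrt" for n
  proof (induction n)
    case (Suc n)
    have "\<forall>s\<in>{0<..}. (sqrt has_vector_derivative inverse (sqrt s) * (1 / 2)) (at s)"
      unfolding has_real_derivative_iff_has_vector_derivative[symmetric]
      using DERIV_real_sqrt by simp
    moreover have "times_differentiable_on n (- {0}) (inverse :: real \<Rightarrow> real)"
      using inv by (simp add: smooth_on_iff_times_differentiable_on open_Compl)
    then have "times_differentiable_on n {0<..} (\<lambda>s. inverse (sqrt s) * (1 / 2))"
      by (intro times_differentiable_on_bilinear[OF bounded_bilinear_mult]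
          times_differentiable_on_const times_differentiable_on_compose[OF _ _ Suc]) auto
    ultimately show ?case
      unfolding times_differentiable_on.simps by fast
  qed simp
  then show "smooth_on {0<..} sqrt"
    by (simp add: smooth_on_iff_times_differentiable_on)
qed (use assms in auto)

lemma smooth_on_arcsin:
  assumes "open I" "smooth_on I f" "\<And>s. s \<in> I \<Longrightarrow> \<bar>f s\<bar> < 1"
  shows "smooth_on I (\<lambda>s. arcsin (f s))"
proof (rule smooth_on_compose[OF assms(1) _ _ assms(2), where J = "{-1<..<1}"])
  have less: "s * s < 1" if "-1 < s" "s < 1" for s :: real
    using that abs_square_less_1[of s] by (auto simp: power2_eq_square)
  show "smooth_on {-1<..<1} arcsin"
  proof (rule smooth_onI)
    show "(arcsin has_vector_derivative inverse (sqrt (1 - s * s))) (at s)"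
      if "s \<in> {-1<..<1}" for s
      unfolding has_real_derivative_iff_has_vector_derivative[symmetric]
      using DERIV_arcsin[of s] that by (simp add: power2_eq_square)
    show "smooth_on {-1<..<1::real} (\<lambda>s. inverse (sqrt (1 - s * s)))"
      using less
      by (intro smooth_on_inverse smooth_on_sqrt smooth_on_diff smooth_on_mult smooth_on_const
          smooth_on_id) force+
  qed simp
qed (use assms in \<open>force simp: abs_less_iff\<close>)+

lemma smooth_on_norm:
  fixes f :: "real \<Rightarrow> 'a::real_inner"
  assumes "open I" "smooth_on I f" "\<And>s. s \<in> I \<Longrightarrow> f s \<noteq> 0"
  shows "smooth_on I (\<lambda>s. norm (f s))"
  unfolding norm_eq_sqrt_inner
  by (intro smooth_on_sqrt smooth_on_inner assms) (simp_all add: assms)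

section \<open>Antiderivatives, angles and arclength\<close>

lemma smooth_on_antiderivative:
  fixes f :: "real \<Rightarrow> 'a::euclidean_space"
  assumes "open I" "is_interval I" "smooth_on I f"
  obtains F where "smooth_on I F" "\<And>s. s \<in> I \<Longrightarrow> (F has_vector_derivative f s) (at s)"
proof (cases "I = {}")
  case True
  then show ?thesis
    using that[of "\<lambda>_. 0"] by (simp add: smooth_on_const)
next
  case False
  then obtain p where p: "p \<in> I"
    by auto
  define F where "F u = (LBINT y=p..u. f y)" for u :: real
  have F: "(F has_vector_derivative f s) (at s)" if s: "s \<in> I" for s
  proof -
    obtain d where d: "d > 0" "cball (min p s) d \<subseteq> I" "cball (max p s) d \<subseteq> I"
    proof -
      have "min p s \<in> I" "max p s \<in> I"
        using p s by (auto simp: min_def max_def)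
      then obtain d1 d2 where "d1 > 0" "cball (min p s) d1 \<subseteq> I" "d2 > 0" "cball (max p s) d2 \<subseteq> I"
        using assms(1) open_contains_cball by meson
      then show ?thesis
        by (intro that[of "min d1 d2"]) auto
    qed
    let ?a = "min p s - d" and ?b = "max p s + d"
    have "?a \<in> I" "?b \<in> I"
      using d by (auto simp: dist_real_def subset_iff)
    then have "{?a..?b} \<subseteq> I"
      using mem_is_interval_1_I[OF assms(2)] by (meson atLeastAtMost_iff subsetI)
    then have "continuous_on {?a..?b} f"
      using smooth_on_continuous_on[OF assms(3)] continuous_on_subset by blast
    then have "(F has_vector_derivative f s) (at s within {?a..?b})"
      unfolding F_def using d(1) by (intro interval_integral_FTC2) auto
    then have "(F has_vector_derivative f s) (at s within {?a<..<?b})"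
      by (rule has_vector_derivative_within_subset) auto
    moreover have "s \<in> {?a<..<?b}"
      using d(1) by auto
    ultimately show ?thesis
      by (simp only: has_vector_derivative_within_open open_greaterThanLessThan)
  qed
  show ?thesis
    using that[OF smooth_onI[OF assms(1) F assms(3)] F] .
qed

lemma has_vector_derivative_zero_imp_constant_on:
  assumes "is_interval I" "\<And>s. s \<in> I \<Longrightarrow> (f has_vector_derivative 0) (at s)"
  shows "\<exists>c. \<forall>s\<in>I. f s = c"
proof (rule has_derivative_zero_constant)
  show "convex I"
    using assms(1) by (rule is_interval_convex)
  show "(f has_derivative (\<lambda>h. 0)) (at s within I)" if "s \<in> I" for s
    using assms(2)[OF that] by (auto simp: has_vector_derivative_def intro: has_derivative_at_withinI)
qed

text \<open>
  A curve \<open>(sin \<theta>, cos \<theta>)\<close> satisfies \<open>\<theta>' = cos \<theta> (sin \<theta>)' - sin \<theta> (cos \<theta>)'\<close>. So the candidate is the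
  antiderivative of \<open>w = y x' - x y'\<close> with the right value at one point. It is an angle for \<open>(x, y)\<close>
  because the inner product \<open>k\<close> of \<open>(x, y)\<close> with \<open>(sin \<theta>, cos \<theta>)\<close> has derivative zero, hence stays
  equal to \<open>1\<close>, and two unit vectors with inner product \<open>1\<close> are equal.
\<close>

lemma smooth_circle_lift:
  fixes x y :: "real \<Rightarrow> real"
  assumes "open I" "is_interval I" "smooth_on I x" "smooth_on I y"
    and unit: "\<And>s. s \<in> I \<Longrightarrow> (x s)\<^sup>2 + (y s)\<^sup>2 = 1"
  obtains \<theta> where "smooth_on I \<theta>" "\<And>s. s \<in> I \<Longrightarrow> x s = sin (\<theta> s) \<and> y s = cos (\<theta> s)"
proof (cases "I = {}")
  case True
  then show ?thesis
    using that[of "\<lambda>_. 0"] by (simp add: smooth_on_const)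
next
  case False
  then obtain p where p: "p \<in> I"
    by auto
  define x' where "x' s = vector_derivative x (at s)" for s
  define y' where "y' s = vector_derivative y (at s)" for s
  define w where "w s = y s * x' s - x s * y' s" for s
  have dx: "(x has_real_derivative x' s) (at s)" and dy: "(y has_real_derivative y' s) (at s)"
    if "s \<in> I" for s
    using smooth_on_has_derivative[OF assms(3) that] smooth_on_has_derivative[OF assms(4) that]
    by (auto simp: x'_def y'_def has_real_derivative_iff_has_vector_derivative)
  have "smooth_on I w"
    unfolding w_def x'_def y'_def
    by (intro smooth_on_diff smooth_on_mult smooth_on_derivative assms)
  then obtain F where F: "smooth_on I F" "\<And>s. s \<in> I \<Longrightarrow> (F has_real_derivative w s) (at s)"
    using smooth_on_antiderivative[OF assms(1,2)]
    unfolding has_real_derivative_iff_has_vector_derivative by metis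
  obtain q where q: "x p = sin q" "y p = cos q"
    using sincos_total_2pi[of "y p" "x p"] unit[OF p] by (metis add.commute)
  define \<theta> where "\<theta> s = F s + (q - F p)" for s
  define k where "k s = x s * sin (\<theta> s) + y s * cos (\<theta> s)" for s
  have d\<theta>: "(\<theta> has_real_derivative w s) (at s)" if "s \<in> I" for s
    unfolding \<theta>_def using F(2)[OF that] by (auto intro!: derivative_eq_intros)
  have "(k has_vector_derivative 0) (at s)" if s: "s \<in> I" for s
  proof -
    have "((\<lambda>s. (x s)\<^sup>2 + (y s)\<^sup>2) has_real_derivative 2 * (x s * x' s + y s * y' s)) (at s)"
      using dx[OF s] dy[OF s] by (auto intro!: derivative_eq_intros simp: algebra_simps)
    moreover have "((\<lambda>s. (x s)\<^sup>2 + (y s)\<^sup>2) has_real_derivative 0) (at s)"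
      by (rule has_field_derivative_transform_within_open[OF DERIV_const[of 1] assms(1) s])
        (simp add: unit)
    ultimately have orth: "x s * x' s + y s * y' s = 0"
      using DERIV_unique by fastforce
    \<comment> \<open>The velocity of a unit vector is \<open>w\<close> times the vector turned by a right angle.\<close>
    have "w s * y s = x' s * ((x s)\<^sup>2 + (y s)\<^sup>2) - x s * (x s * x' s + y s * y' s)"
      "w s * x s = - y' s * ((x s)\<^sup>2 + (y s)\<^sup>2) + y s * (x s * x' s + y s * y' s)"
      by (simp_all add: w_def algebra_simps power2_eq_square)
    then have w: "x' s = w s * y s" "y' s = - (w s * x s)"
      using orth unit[OF s] by simp_all
    have "(k has_real_derivative x' s * sin (\<theta> s) + x s * (cos (\<theta> s) * w s)
        + (y' s * cos (\<theta> s) - y s * (sin (\<theta> s) * w s))) (at s)"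
      unfolding k_def using dx[OF s] dy[OF s] d\<theta>[OF s] by (auto intro!: derivative_eq_intros)
    moreover have "x' s * sin (\<theta> s) + x s * (cos (\<theta> s) * w s)
        + (y' s * cos (\<theta> s) - y s * (sin (\<theta> s) * w s)) = 0"
      by (simp add: w algebra_simps)
    ultimately show ?thesis
      by (simp add: has_real_derivative_iff_has_vector_derivative)
  qed
  then obtain c where c: "\<And>s. s \<in> I \<Longrightarrow> k s = c"
    using has_vector_derivative_zero_imp_constant_on[OF assms(2)] by metis
  have "k p = 1"
    by (simp add: k_def \<theta>_def q power2_eq_square[symmetric])
  then have k: "k s = 1" if "s \<in> I" for s
    using c p that by metis
  show ?thesis
  proof (rule that)
    show "smooth_on I \<theta>"
      unfolding \<theta>_def by (intro smooth_on_add smooth_on_const F assms(1))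
    show "x s = sin (\<theta> s) \<and> y s = cos (\<theta> s)" if s: "s \<in> I" for s
    proof -
      have "(x s - sin (\<theta> s))\<^sup>2 + (y s - cos (\<theta> s))\<^sup>2
          = ((x s)\<^sup>2 + (y s)\<^sup>2) + ((sin (\<theta> s))\<^sup>2 + (cos (\<theta> s))\<^sup>2) - 2 * k s"
        by (simp add: k_def power2_eq_square algebra_simps)
      also have "\<dots> = 0"
        using unit[OF s] k[OF s] by simp
      finally show ?thesis
        by (simp add: sum_power2_eq_zero_iff)
    qed
  qed
qed

text \<open>
  The arclength function \<open>t\<close> has positive derivative \<open>v\<close>, so it maps \<open>I\<close> bijectively onto an open
  interval, with an inverse \<open>g\<close>, and the reparametrized curve is \<open>\<gamma> \<circ> g\<close>.
\<close>

lemma arclength_reparametrization: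
  fixes \<gamma> :: "real \<Rightarrow> real^3"
  assumes "open I" "is_interval I" "smooth_on I \<gamma>"
    and regular: "\<And>s. s \<in> I \<Longrightarrow> vector_derivative \<gamma> (at s) \<noteq> 0"
  obtains J \<beta> t where "open J" "is_interval J" "unit_speed_curve J \<beta>" "smooth_on I t"
    "J = t ` I" "\<And>s. s \<in> I \<Longrightarrow> \<gamma> s = \<beta> (t s)"
proof -
  define \<gamma>' where "\<gamma>' s = vector_derivative \<gamma> (at s)" for s
  define v where "v s = norm (\<gamma>' s)" for s
  have v_pos: "v s > 0" if "s \<in> I" for s
    using regular[OF that] by (simp add: v_def \<gamma>'_def)
  have smooth_\<gamma>': "smooth_on I \<gamma>'"
    unfolding \<gamma>'_def by (rule smooth_on_derivative[OF assms(3)])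
  have smooth_v: "smooth_on I v"
    unfolding v_def using regular
    by (intro smooth_on_norm smooth_\<gamma>' assms(1)) (simp add: \<gamma>'_def)
  obtain t where smooth_t: "smooth_on I t"
    and dt: "\<And>s. s \<in> I \<Longrightarrow> (t has_real_derivative v s) (at s)"
    using smooth_on_antiderivative[OF assms(1,2) smooth_v]
    unfolding has_real_derivative_iff_has_vector_derivative by metis
  have less: "t x < t y" if "x \<in> I" "y \<in> I" "x < y" for x y
  proof (rule DERIV_pos_imp_increasing[OF \<open>x < y\<close>])
    fix u assume "x \<le> u" "u \<le> y"
    then have "u \<in> I"
      using that assms(2) mem_is_interval_1_I by blast
    then show "\<exists>d. (t has_real_derivative d) (at u) \<and> d > 0"
      using dt v_pos by blast
  qed
  then have inj: "inj_on t I"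
    by (intro linorder_inj_onI') (metis less_irrefl)
  define J where "J = t ` I"
  define g where "g = the_inv_into I t"
  have gt: "g (t s) = s" if "s \<in> I" for s
    using the_inv_into_f_f[OF inj that] by (simp add: g_def)
  have cont_t: "continuous_on I t"
    using smooth_t by (rule smooth_on_continuous_on)
  have J: "open J" "is_interval J"
    using invariance_of_domain[OF cont_t assms(1) inj] connected_continuous_image[OF cont_t] assms(2)
    by (auto simp: J_def is_interval_connected_1)
  have g_mem: "g u \<in> I" and tg: "t (g u) = u" if "u \<in> J" for u
    using that gt by (auto simp: J_def)
  have cont_g: "continuous_on J g"
    unfolding J_def by (rule continuous_on_inverse_open) (use assms cont_t gt in auto)
  have dg: "(g has_vector_derivative inverse (v (g u))) (at u)" if u: "u \<in> J" for u
  proof -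
    obtain e where e: "e > 0" "ball u e \<subseteq> J"
      using J(1) u open_contains_ball by blast
    have "(g has_real_derivative inverse (v (g u))) (at u)"
    proof (rule DERIV_inverse_function)
      show "(t has_real_derivative v (g u)) (at (g u))" "v (g u) \<noteq> 0"
        using dt v_pos g_mem[OF u] by force+
      show "u - e < u" "u < u + e"
        using e by auto
      show "t (g y) = y" if "u - e < y" "y < u + e" for y
        using e that by (intro tg) (auto simp: subset_iff dist_real_def)
      show "isCont g u"
        using cont_g J(1) u continuous_on_eq_continuous_at by blast
    qed
    then show ?thesis
      by (simp add: has_real_derivative_iff_has_vector_derivative)
  qed
  \<comment> \<open>A derivative \<open>(h \<circ> g)' = (h' / v) \<circ> g\<close> is again a smooth function on \<open>I\<close> composed with \<open>g\<close>.
    Letting \<open>h\<close> vary therefore closes the induction without first proving that \<open>g\<close> is smooth.\<close>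
  have smooth_g: "times_differentiable_on n J (\<lambda>u. h (g u))" if "smooth_on I h"
    for n and h :: "real \<Rightarrow> real^3"
    using that
  proof (induction n arbitrary: h)
    case (Suc n)
    define h' where "h' s = vector_derivative h (at s)" for s
    have "((\<lambda>u. h (g u)) has_vector_derivative inverse (v (g u)) *\<^sub>R h' (g u)) (at u)"
      if "u \<in> J" for u
      using vector_diff_chain_at[OF dg[OF that] smooth_on_has_derivative[OF Suc.prems g_mem[OF that]]]
      by (simp add: o_def h'_def)
    moreover have "smooth_on I (\<lambda>s. inverse (v s) *\<^sub>R h' s)"
      unfolding h'_def using v_pos
      by (intro smooth_on_scaleR smooth_on_inverse smooth_on_derivative smooth_v assms Suc.prems)
        force
    then have "times_differentiable_on n J (\<lambda>u. inverse (v (g u)) *\<^sub>R h' (g u))"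
      by (rule Suc.IH)
    ultimately show ?case
      unfolding times_differentiable_on.simps by fast
  qed simp
  have "vector_derivative (\<lambda>u. \<gamma> (g u)) (at u) = inverse (v (g u)) *\<^sub>R \<gamma>' (g u)" if "u \<in> J" for u
    using vector_diff_chain_at[OF dg[OF that] smooth_on_has_derivative[OF assms(3) g_mem[OF that]]]
    by (simp add: o_def vector_derivative_at \<gamma>'_def)
  moreover have "norm (inverse (v s) *\<^sub>R \<gamma>' s) = 1" if "s \<in> I" for s
    using v_pos[OF that] by (simp add: v_def)
  ultimately have "unit_speed_curve J (\<lambda>u. \<gamma> (g u))"
    unfolding unit_speed_curve_def using smooth_g[OF assms(3)] g_mem
    by (simp add: smooth_on_iff_times_differentiable_on[OF J(1)])
  then show ?thesis
    using that[OF J _ smooth_t J_def, of "\<lambda>u. \<gamma> (g u)"] gt by simp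
qed

section \<open>The Frenet frame\<close>

lemma derivative_of_constant_inner:
  assumes "open I" "s \<in> I" "\<And>u. u \<in> I \<Longrightarrow> f u \<bullet> g u = c"
    and "(f has_vector_derivative f') (at s)" "(g has_vector_derivative g') (at s)"
  shows "f s \<bullet> g' + f' \<bullet> g s = 0"
proof -
  have "((\<lambda>u. f u \<bullet> g u) has_vector_derivative f s \<bullet> g' + f' \<bullet> g s) (at s)"
    using assms(4,5) by (rule bounded_bilinear.has_vector_derivative[OF bounded_bilinear_inner])
  moreover have "((\<lambda>u. f u \<bullet> g u) has_vector_derivative 0) (at s)"
    by (rule has_vector_derivative_transform_within_open[OF has_vector_derivative_const[of c]
        assms(1,2)]) (simp add: assms(3))
  ultimately show ?thesis
    by (rule vector_derivative_unique_at)
qed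

text \<open>
  A vector \<open>y\<close> orthogonal to \<open>e\<close> and \<open>f\<close> has \<open>y \<times> (e \<times> f) = 0\<close> by the Lagrange formula; if it is also
  orthogonal to \<open>e \<times> f\<close>, it is zero. Apply this to the difference of both sides.
\<close>

lemma orthonormal_cross3_expansion:
  fixes e f x :: "real^3"
  assumes "e \<bullet> e = 1" "f \<bullet> f = 1" "e \<bullet> f = 0"
  shows "x = (x \<bullet> e) *\<^sub>R e + (x \<bullet> f) *\<^sub>R f + (x \<bullet> cross3 e f) *\<^sub>R cross3 e f"
proof -
  have g: "cross3 e f \<bullet> cross3 e f = 1"
    using assms by (simp add: dot_cross inner_commute)
  define y where "y = x - ((x \<bullet> e) *\<^sub>R e + (x \<bullet> f) *\<^sub>R f + (x \<bullet> cross3 e f) *\<^sub>R cross3 e f)"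
  have y: "y \<bullet> e = 0" "y \<bullet> f = 0" "y \<bullet> cross3 e f = 0"
    using assms g by (simp_all add: y_def algebra_simps dot_cross_self inner_commute[of f e])
  then have "cross3 y (cross3 e f) = 0"
    by (simp add: Lagrange)
  then have "(norm y)\<^sup>2 * (norm (cross3 e f))\<^sup>2 = 0"
    using norm_cross_dot[of y "cross3 e f"] y(3) by (simp add: power_mult_distrib)
  then have "y = 0"
    using g by auto
  then show ?thesis
    by (simp add: y_def)
qed

locale frenet_curve =
  fixes I :: "real set" and \<alpha> :: "real \<Rightarrow> real^3"
  assumes open_I: "open I" and unit_speed: "unit_speed_curve I \<alpha>"
    and curvature_pos: "\<And>s. s \<in> I \<Longrightarrow> curvature \<alpha> s > 0"
begin

abbreviation "T \<equiv> tangent \<alpha>"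
abbreviation "N \<equiv> principal_normal \<alpha>"
abbreviation "B \<equiv> binormal \<alpha>"
abbreviation "\<kappa> \<equiv> curvature \<alpha>"
abbreviation "\<tau> \<equiv> torsion \<alpha>"

lemma smooth_curve: "smooth_on I \<alpha>"
  using unit_speed by (simp add: unit_speed_curve_def)

lemma smooth_tangent: "smooth_on I T"
  unfolding tangent_def[abs_def] by (rule smooth_on_derivative[OF smooth_curve])

lemma smooth_curvature: "smooth_on I \<kappa>"
  unfolding curvature_def[abs_def] using curvature_pos
  by (intro smooth_on_norm smooth_on_derivative smooth_tangent open_I)
    (force simp: curvature_def)

lemma smooth_normal: "smooth_on I N"
  unfolding principal_normal_def[abs_def] using curvature_pos
  by (intro smooth_on_scaleR smooth_on_inverse smooth_on_derivative smooth_tangent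
      smooth_curvature open_I) force

lemma smooth_binormal: "smooth_on I B"
  unfolding binormal_def[abs_def]
  by (intro smooth_on_cross3 smooth_tangent smooth_normal open_I)

lemma smooth_torsion: "smooth_on I \<tau>"
  unfolding torsion_def[abs_def]
  by (intro smooth_on_minus smooth_on_inner smooth_on_derivative smooth_binormal smooth_normal open_I)

lemma curve_derivative: "s \<in> I \<Longrightarrow> (\<alpha> has_vector_derivative T s) (at s)"
  unfolding tangent_def by (rule smooth_on_has_derivative[OF smooth_curve])

lemma frenet_tangent: "s \<in> I \<Longrightarrow> (T has_vector_derivative \<kappa> s *\<^sub>R N s) (at s)"
  using smooth_on_has_derivative[OF smooth_tangent] curvature_pos[of s]
  by (simp add: principal_normal_def)

text \<open>
  Only \<open>\<langle>T, N\<rangle> = 0\<close> is not immediate; it comes from differentiating \<open>\<langle>T, T\<rangle> = 1\<close>.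
\<close>

lemma frame_inner:
  assumes "s \<in> I"
  shows "T s \<bullet> T s = 1" "N s \<bullet> N s = 1" "B s \<bullet> B s = 1"
    "T s \<bullet> N s = 0" "N s \<bullet> T s = 0" "T s \<bullet> B s = 0" "B s \<bullet> T s = 0" "N s \<bullet> B s = 0" "B s \<bullet> N s = 0"
proof -
  have TT: "T u \<bullet> T u = 1" if "u \<in> I" for u
    using unit_speed that by (simp add: unit_speed_curve_def tangent_def norm_eq_1)
  have NN: "N s \<bullet> N s = 1"
    using curvature_pos[OF assms] unfolding norm_eq_1[symmetric]
    by (simp add: principal_normal_def curvature_def)
  have TN: "T s \<bullet> N s = 0"
    using derivative_of_constant_inner[OF open_I assms TT frenet_tangent[OF assms]
        frenet_tangent[OF assms]] curvature_pos[OF assms]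
    by (simp add: inner_commute)
  show "T s \<bullet> T s = 1" "N s \<bullet> N s = 1" "T s \<bullet> N s = 0" "N s \<bullet> T s = 0"
    using TT[OF assms] NN TN by (simp_all add: inner_commute)
  then show "B s \<bullet> B s = 1" "T s \<bullet> B s = 0" "B s \<bullet> T s = 0" "N s \<bullet> B s = 0" "B s \<bullet> N s = 0"
    by (simp_all add: binormal_def dot_cross dot_cross_self)
qed

lemma frame_expansion:
  assumes "s \<in> I"
  shows "x = (x \<bullet> T s) *\<^sub>R T s + (x \<bullet> N s) *\<^sub>R N s + (x \<bullet> B s) *\<^sub>R B s"
  unfolding binormal_def by (rule orthonormal_cross3_expansion) (simp_all add: frame_inner assms)

lemma frame_cross:
  assumes "s \<in> I"
  shows "cross3 (T s) (N s) = B s" "cross3 (N s) (T s) = - B s"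
    "cross3 (T s) (B s) = - N s" "cross3 (B s) (T s) = N s"
    "cross3 (N s) (B s) = T s" "cross3 (B s) (N s) = - T s"
proof -
  show TN: "cross3 (T s) (N s) = B s"
    by (simp add: binormal_def)
  show TB: "cross3 (T s) (B s) = - N s" and NB: "cross3 (N s) (B s) = T s"
    using frame_inner[OF assms] by (simp_all add: binormal_def Lagrange)
  show "cross3 (N s) (T s) = - B s" "cross3 (B s) (T s) = N s" "cross3 (B s) (N s) = - T s"
    by (subst cross_skew, simp add: TN TB NB)+
qed

text \<open>
  In this and the next lemma, the coordinates of the derivative in the frame are found by
  differentiating the constant inner products of the frame vectors.
\<close>

lemma frenet_binormal:
  assumes "s \<in> I"
  shows "(B has_vector_derivative - \<tau> s *\<^sub>R N s) (at s)"
proof -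
  let ?B' = "vector_derivative B (at s)"
  note dB = smooth_on_has_derivative[OF smooth_binormal assms]
  have "?B' \<bullet> T s = 0"
    using derivative_of_constant_inner[OF open_I assms _ dB frenet_tangent[OF assms], of 0]
    by (simp add: frame_inner assms)
  moreover have "?B' \<bullet> B s = 0"
    using derivative_of_constant_inner[OF open_I assms _ dB dB, of 1]
    by (simp add: frame_inner inner_commute)
  ultimately have "?B' = - \<tau> s *\<^sub>R N s"
    using frame_expansion[OF assms, of ?B'] by (simp add: torsion_def)
  then show ?thesis
    using dB by simp
qed

lemma frenet_normal:
  assumes "s \<in> I"
  shows "(N has_vector_derivative - \<kappa> s *\<^sub>R T s + \<tau> s *\<^sub>R B s) (at s)"
proof -
  let ?N' = "vector_derivative N (at s)"
  note dN = smooth_on_has_derivative[OF smooth_normal assms]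
  have "?N' \<bullet> T s = - \<kappa> s"
    using derivative_of_constant_inner[OF open_I assms _ dN frenet_tangent[OF assms], of 0]
    by (simp add: frame_inner assms)
  moreover have "?N' \<bullet> B s = \<tau> s"
    using derivative_of_constant_inner[OF open_I assms _ dN frenet_binormal[OF assms], of 0]
    by (simp add: frame_inner assms)
  moreover have "?N' \<bullet> N s = 0"
    using derivative_of_constant_inner[OF open_I assms _ dN dN, of 1]
    by (simp add: frame_inner inner_commute)
  ultimately have "?N' = - \<kappa> s *\<^sub>R T s + \<tau> s *\<^sub>R B s"
    using frame_expansion[OF assms, of ?N'] by simp
  then show ?thesis
    using dN by simp
qed

text \<open>
  The Frenet equations say that \<open>T\<close>, \<open>N\<close> and \<open>B\<close> each satisfy \<open>X' = D \<times> X\<close> for the Darboux vector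
  \<open>D\<close>, and this equation is linear in \<open>X\<close>.
\<close>

lemma constant_coefficients_F_constant:
  "F_constant I \<alpha> (\<lambda>s. a *\<^sub>R T s + b *\<^sub>R N s + c *\<^sub>R B s)" (is "F_constant I \<alpha> ?W")
  unfolding F_constant_def
proof (intro conjI ballI)
  show "smooth_on I ?W"
    by (intro smooth_on_add smooth_on_scaleR smooth_on_const smooth_tangent smooth_normal
        smooth_binormal open_I)
  fix s assume s: "s \<in> I"
  have "(?W has_vector_derivative a *\<^sub>R (\<kappa> s *\<^sub>R N s) + b *\<^sub>R (- \<kappa> s *\<^sub>R T s + \<tau> s *\<^sub>R B s)
      + c *\<^sub>R (- \<tau> s *\<^sub>R N s)) (at s)"
    by (intro has_vector_derivative_add
        bounded_linear.has_vector_derivative[OF bounded_linear_scaleR_right]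
        frenet_tangent frenet_normal frenet_binormal s)
  moreover have "a *\<^sub>R (\<kappa> s *\<^sub>R N s) + b *\<^sub>R (- \<kappa> s *\<^sub>R T s + \<tau> s *\<^sub>R B s)
      + c *\<^sub>R (- \<tau> s *\<^sub>R N s) = cross3 (darboux \<alpha> s) (?W s)"
    by (simp add: darboux_def cross_add_left cross_add_right cross_mult_left cross_mult_right
        frame_cross s algebra_simps)
  ultimately show "(?W has_vector_derivative cross3 (darboux \<alpha> s) (?W s)) (at s)"
    by simp
qed

text \<open>
  Without torsion the binormal is a constant vector \<open>n\<close>, and \<open>\<langle>\<alpha>, n\<rangle>\<close> has derivative \<open>\<langle>T, B\<rangle> = 0\<close>.
  So \<open>\<alpha>\<close> stays in the osculating plane of any of its points \<open>\<alpha> p\<close>.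
\<close>

lemma coplanar_if_torsion_zero:
  assumes "is_interval I" "\<And>s. s \<in> I \<Longrightarrow> \<tau> s = 0"
  shows "coplanar (\<alpha> ` I)"
proof (cases "I = {}")
  case True
  then show ?thesis
    by (simp add: coplanar_def)
next
  case False
  then obtain p where p: "p \<in> I"
    by auto
  have "(B has_vector_derivative 0) (at s)" if "s \<in> I" for s
    using frenet_binormal[OF that] assms(2)[OF that] by simp
  then obtain n where n: "\<And>s. s \<in> I \<Longrightarrow> B s = n"
    using has_vector_derivative_zero_imp_constant_on[OF assms(1)] by metis
  have "((\<lambda>s. \<alpha> s \<bullet> n) has_vector_derivative 0) (at s)" if "s \<in> I" for s
    using bounded_linear.has_vector_derivative[OF bounded_linear_inner_left
        curve_derivative[OF that], of n] frame_inner(6)[OF that] n[OF that] by simp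
  then obtain d where d: "\<And>s. s \<in> I \<Longrightarrow> \<alpha> s \<bullet> n = d"
    using has_vector_derivative_zero_imp_constant_on[OF assms(1)] by metis
  have "\<alpha> s \<in> affine hull {\<alpha> p, \<alpha> p + T p, \<alpha> p + N p}" if s: "s \<in> I" for s
  proof -
    define u where "u = (\<alpha> s - \<alpha> p) \<bullet> T p"
    define v where "v = (\<alpha> s - \<alpha> p) \<bullet> N p"
    have "(\<alpha> s - \<alpha> p) \<bullet> B p = 0"
      using d[OF s] d[OF p] n[OF p] by (simp add: inner_diff_left)
    then have "\<alpha> s - \<alpha> p = u *\<^sub>R T p + v *\<^sub>R N p"
      using frame_expansion[OF p, of "\<alpha> s - \<alpha> p"] by (simp add: u_def v_def)
    then have "\<alpha> s = (1 - u - v) *\<^sub>R \<alpha> p + u *\<^sub>R (\<alpha> p + T p) + v *\<^sub>R (\<alpha> p + N p)"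
      by (simp add: algebra_simps)
    moreover have "(1 - u - v) + u + v = 1"
      by simp
    ultimately show ?thesis
      unfolding affine_hull_3 by blast
  qed
  then show ?thesis
    unfolding coplanar_def by blast
qed

section \<open>A fixed direction in the Frenet frame\<close>

lemma coordinate_derivatives:
  assumes "s \<in> I"
  shows "((\<lambda>s. T s \<bullet> V) has_vector_derivative \<kappa> s * (N s \<bullet> V)) (at s)"
    and "((\<lambda>s. N s \<bullet> V) has_vector_derivative - \<kappa> s * (T s \<bullet> V) + \<tau> s * (B s \<bullet> V)) (at s)"
    and "((\<lambda>s. B s \<bullet> V) has_vector_derivative - \<tau> s * (N s \<bullet> V)) (at s)"
  using bounded_linear.has_vector_derivative[OF bounded_linear_inner_left frenet_tangent[OF assms], of V]
    bounded_linear.has_vector_derivative[OF bounded_linear_inner_left frenet_normal[OF assms], of V]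
    bounded_linear.has_vector_derivative[OF bounded_linear_inner_left frenet_binormal[OF assms], of V]
  by (simp_all add: inner_add_left inner_diff_left)

lemma unit_coordinates:
  assumes "s \<in> I" "norm V = 1"
  shows "(T s \<bullet> V)\<^sup>2 + (N s \<bullet> V)\<^sup>2 + (B s \<bullet> V)\<^sup>2 = 1"
proof -
  have "V \<bullet> V = (T s \<bullet> V)\<^sup>2 + (N s \<bullet> V)\<^sup>2 + (B s \<bullet> V)\<^sup>2"
    by (subst frame_expansion[OF assms(1), of V])
      (simp add: inner_add_left inner_commute[of V] power2_eq_square)
  then show ?thesis
    using assms(2) by (simp add: norm_eq_1)
qed

text \<open>
  Differentiating \<open>\<langle>B, V\<rangle> = 0\<close> gives \<open>\<tau> \<langle>N, V\<rangle> = 0\<close>. If \<open>\<tau> s \<noteq> 0\<close>, then \<open>\<langle>N, V\<rangle>\<close> vanishes near \<open>s\<close>,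
  hence so does its derivative \<open>- \<kappa> \<langle>T, V\<rangle>\<close> at \<open>s\<close>, and \<open>V\<close> would be zero.
\<close>

lemma torsion_zero_if_binormal_orthogonal:
  assumes "norm V = 1" "\<And>s. s \<in> I \<Longrightarrow> B s \<bullet> V = 0" "s \<in> I"
  shows "\<tau> s = 0"
proof (rule ccontr)
  assume nz: "\<tau> s \<noteq> 0"
  have tn: "\<tau> u * (N u \<bullet> V) = 0" if "u \<in> I" for u
  proof -
    have "((\<lambda>s. B s \<bullet> V) has_vector_derivative 0) (at u)"
      by (rule has_vector_derivative_transform_within_open[OF has_vector_derivative_const[of 0]
          open_I that]) (simp add: assms(2))
    then show ?thesis
      using vector_derivative_unique_at[OF coordinate_derivatives(3)[OF that]] by fastforce
  qed
  define U where "U = {u \<in> I. \<tau> u \<noteq> 0}"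
  have "open U"
  proof -
    have "open (I \<inter> \<tau> -` (- {0}))"
      by (intro continuous_open_preimage smooth_on_continuous_on smooth_torsion open_I) auto
    also have "I \<inter> \<tau> -` (- {0}) = U"
      by (auto simp: U_def)
    finally show ?thesis .
  qed
  moreover have "s \<in> U" and N0: "\<And>u. u \<in> U \<Longrightarrow> N u \<bullet> V = 0"
    using assms(3) nz tn by (auto simp: U_def)
  ultimately have dN: "((\<lambda>s. N s \<bullet> V) has_vector_derivative 0) (at s)"
    by (intro has_vector_derivative_transform_within_open[OF has_vector_derivative_const[of 0]])
      (auto simp: N0)
  have "\<kappa> s * (T s \<bullet> V) = 0"
    using vector_derivative_unique_at[OF coordinate_derivatives(2)[OF assms(3)] dN]
      assms(2,3) by simp
  then show False
    using unit_coordinates[OF assms(3,1)] assms(2,3) N0[OF \<open>s \<in> U\<close>] curvature_pos[OF assms(3)]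
    by simp
qed

text \<open>
  At a point where \<open>T = \<plusminus>V\<close>, the relation \<open>orth\<close> reduces to \<open>a = 0\<close> and its derivative to
  \<open>b \<kappa> = 0\<close>. What is left says that \<open>B\<close> is orthogonal to \<open>V\<close> everywhere, so the curve would be planar.
\<close>

lemma axis_nowhere_tangent:
  assumes "is_interval I" "\<not> coplanar (\<alpha> ` I)" "norm V = 1" "a\<^sup>2 + b\<^sup>2 + c\<^sup>2 = 1"
    and orth: "\<And>s. s \<in> I \<Longrightarrow> a * (T s \<bullet> V) + b * (N s \<bullet> V) + c * (B s \<bullet> V) = 0"
    and s: "s \<in> I"
  shows "\<bar>T s \<bullet> V\<bar> < 1"
proof (rule ccontr)
  assume "\<not> \<bar>T s \<bullet> V\<bar> < 1"
  then have "1 \<le> (T s \<bullet> V)\<^sup>2"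
    by (metis abs_square_less_1 not_less)
  then have "(N s \<bullet> V)\<^sup>2 + (B s \<bullet> V)\<^sup>2 \<le> 0"
    using unit_coordinates[OF s assms(3)] by linarith
  then have NB: "N s \<bullet> V = 0" "B s \<bullet> V = 0"
    by (simp_all add: sum_power2_le_zero_iff)
  then have T: "T s \<bullet> V \<noteq> 0"
    using unit_coordinates[OF s assms(3)] by auto
  have a: "a = 0"
    using orth[OF s] NB T by simp
  have "((\<lambda>s. b * (N s \<bullet> V) + c * (B s \<bullet> V)) has_vector_derivative
      b * (- \<kappa> s * (T s \<bullet> V) + \<tau> s * (B s \<bullet> V)) + c * (- \<tau> s * (N s \<bullet> V))) (at s)"
    by (intro has_vector_derivative_add
        bounded_linear.has_vector_derivative[OF bounded_linear_mult_right]
        coordinate_derivatives s)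
  moreover have "((\<lambda>s. b * (N s \<bullet> V) + c * (B s \<bullet> V)) has_vector_derivative 0) (at s)"
    by (rule has_vector_derivative_transform_within_open[OF has_vector_derivative_const[of 0]
        open_I s]) (use orth a in simp)
  ultimately have "b * (- \<kappa> s * (T s \<bullet> V) + \<tau> s * (B s \<bullet> V)) + c * (- \<tau> s * (N s \<bullet> V)) = 0"
    by (rule vector_derivative_unique_at)
  then have b: "b = 0"
    using NB T curvature_pos[OF s] by simp
  then have "c \<noteq> 0"
    using a assms(4) by auto
  then have "B u \<bullet> V = 0" if "u \<in> I" for u
    using orth[OF that] a b by simp
  then have "\<tau> u = 0" if "u \<in> I" for u
    using torsion_zero_if_binormal_orthogonal[OF assms(3) _ that] by blast
  then show False
    using coplanar_if_torsion_zero[OF assms(1)] assms(2) by blast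
qed

text \<open>
  Since \<open>\<bar>\<langle>T, V\<rangle>\<bar> < 1\<close>, the length \<open>r = cos \<phi>\<close> of the part of \<open>V\<close> normal to the curve is positive,
  and dividing by it puts the normal coordinates on the unit circle, where an angle can be lifted.
\<close>

lemma angle_functions_exist:
  assumes "is_interval I" "norm V = 1" "\<And>s. s \<in> I \<Longrightarrow> \<bar>T s \<bullet> V\<bar> < 1"
  obtains \<phi> \<theta> where "angle_functions I \<alpha> V \<phi> \<theta>" "\<And>s. s \<in> I \<Longrightarrow> cos (\<phi> s) \<noteq> 0"
proof -
  define \<phi> where "\<phi> s = arcsin (T s \<bullet> V)" for s
  define r where "r s = sqrt (1 - (T s \<bullet> V) * (T s \<bullet> V))" for s
  have less: "(T s \<bullet> V) * (T s \<bullet> V) < 1" if "s \<in> I" for s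
    using assms(3)[OF that] abs_square_less_1[of "T s \<bullet> V"] by (simp add: power2_eq_square)
  have r_pos: "r s > 0" and r2: "(r s)\<^sup>2 = 1 - (T s \<bullet> V)\<^sup>2" if "s \<in> I" for s
    using less[OF that] by (simp_all add: r_def power2_eq_square)
  have sin\<phi>: "sin (\<phi> s) = T s \<bullet> V" and cos\<phi>: "cos (\<phi> s) = r s" if "s \<in> I" for s
    using assms(3)[OF that]
    by (simp_all add: \<phi>_def r_def abs_less_iff cos_arcsin power2_eq_square)
  have smooth_V: "smooth_on I (\<lambda>s. X s \<bullet> V)" if "smooth_on I X" for X :: "real \<Rightarrow> real^3"
    using that by (intro smooth_on_inner smooth_on_const open_I)
  have smooth_\<phi>: "smooth_on I \<phi>"
    unfolding \<phi>_def by (intro smooth_on_arcsin smooth_V smooth_tangent open_I assms(3))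
  have "smooth_on I r"
    unfolding r_def using less
    by (intro smooth_on_sqrt smooth_on_diff smooth_on_mult smooth_on_const smooth_V smooth_tangent
        open_I) simp
  then have smooth_ir: "smooth_on I (\<lambda>s. inverse (r s))"
    by (rule smooth_on_inverse[OF open_I]) (metis less_irrefl r_pos)
  obtain \<theta> where \<theta>: "smooth_on I \<theta>"
    "\<And>s. s \<in> I \<Longrightarrow> inverse (r s) * (N s \<bullet> V) = sin (\<theta> s) \<and> - (inverse (r s) * (B s \<bullet> V)) = cos (\<theta> s)"
  proof (rule smooth_circle_lift[OF open_I assms(1)])
    show "smooth_on I (\<lambda>s. inverse (r s) * (N s \<bullet> V))"
      "smooth_on I (\<lambda>s. - (inverse (r s) * (B s \<bullet> V)))"
      by (intro smooth_on_minus smooth_on_mult smooth_ir smooth_V smooth_normal smooth_binormal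
          open_I)+
    show "(inverse (r s) * (N s \<bullet> V))\<^sup>2 + (- (inverse (r s) * (B s \<bullet> V)))\<^sup>2 = 1" if "s \<in> I" for s
    proof -
      have "(inverse (r s) * (N s \<bullet> V))\<^sup>2 + (- (inverse (r s) * (B s \<bullet> V)))\<^sup>2
          = ((N s \<bullet> V)\<^sup>2 + (B s \<bullet> V)\<^sup>2) / (r s)\<^sup>2"
        by (simp add: power_mult_distrib power_inverse divide_inverse algebra_simps)
      also have "(N s \<bullet> V)\<^sup>2 + (B s \<bullet> V)\<^sup>2 = (r s)\<^sup>2"
        using unit_coordinates[OF that assms(2)] r2[OF that] by simp
      finally show ?thesis
        using r_pos[OF that] by simp
    qed
  qed blast
  have N: "N s \<bullet> V = cos (\<phi> s) * sin (\<theta> s)" and B: "B s \<bullet> V = - cos (\<phi> s) * cos (\<theta> s)"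
    if "s \<in> I" for s
    using \<theta>(2)[OF that] r_pos[OF that] cos\<phi>[OF that] by (auto simp: field_simps)
  have "angle_functions I \<alpha> V \<phi> \<theta>"
    unfolding angle_functions_def
  proof (intro conjI ballI smooth_\<phi> \<theta>(1) sin\<phi>)
    fix s assume s: "s \<in> I"
    show "sin (\<theta> s) * (B s \<bullet> V) + cos (\<theta> s) * (N s \<bullet> V) = 0"
      using N[OF s] B[OF s] by simp
    show "V = sin (\<phi> s) *\<^sub>R T s + cos (\<phi> s) *\<^sub>R (sin (\<theta> s) *\<^sub>R N s - cos (\<theta> s) *\<^sub>R B s)"
      using frame_expansion[OF s, of V] N[OF s] B[OF s] sin\<phi>[OF s]
      by (simp add: inner_commute[of V] algebra_simps)
  qed
  then show ?thesis
    using that cos\<phi> r_pos by (metis less_irrefl)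
qed

text \<open>
  The base curve is the projection \<open>\<gamma>\<close> of \<open>\<alpha>\<close> to the plane through the origin orthogonal to \<open>V\<close>,
  parametrized by arclength. It is regular because its velocity \<open>T - \<langle>T, V\<rangle> V\<close> can only vanish where
  \<open>T\<close> is parallel to \<open>V\<close>.
\<close>

lemma contained_in_cylinder_if_nowhere_tangent:
  assumes "is_interval I" "norm V = 1" "\<And>s. s \<in> I \<Longrightarrow> \<bar>T s \<bullet> V\<bar> < 1"
  obtains J \<beta> where "cylinder_base J \<beta> V" "contained_in_cylinder I \<alpha> J \<beta> V"
proof -
  define \<gamma> where "\<gamma> s = \<alpha> s - (\<alpha> s \<bullet> V) *\<^sub>R V" for s
  have VV: "V \<bullet> V = 1"
    using assms(2) by (simp add: norm_eq_1)
  have smooth_z: "smooth_on I (\<lambda>s. \<alpha> s \<bullet> V)"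
    by (intro smooth_on_inner smooth_on_const smooth_curve open_I)
  have smooth_\<gamma>: "smooth_on I \<gamma>"
    unfolding \<gamma>_def
    by (intro smooth_on_diff smooth_on_scaleR smooth_z smooth_on_const smooth_curve open_I)
  have "vector_derivative \<gamma> (at s) \<noteq> 0" if s: "s \<in> I" for s
  proof -
    have "bounded_linear (\<lambda>x. x - (x \<bullet> V) *\<^sub>R V)"
      by (intro bounded_linear_sub bounded_linear_ident bounded_linear_scaleR_const
          bounded_linear_inner_left)
    from bounded_linear.has_vector_derivative[OF this curve_derivative[OF s]]
    have "vector_derivative \<gamma> (at s) = T s - (T s \<bullet> V) *\<^sub>R V"
      unfolding \<gamma>_def by (rule vector_derivative_at)
    moreover have "norm (T s) = 1" "norm ((T s \<bullet> V) *\<^sub>R V) < 1"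
      using frame_inner(1)[OF s] assms(2) assms(3)[OF s] by (simp add: norm_eq_1, simp)
    ultimately show ?thesis
      by (metis eq_iff_diff_eq_0 less_irrefl)
  qed
  then obtain J \<beta> t where J: "open J" "is_interval J" "unit_speed_curve J \<beta>" "smooth_on I t"
    "J = t ` I" "\<And>s. s \<in> I \<Longrightarrow> \<gamma> s = \<beta> (t s)"
    using arclength_reparametrization[OF open_I assms(1) smooth_\<gamma>] by metis
  have "\<beta> u \<bullet> V = 0" if u: "u \<in> J" for u
  proof -
    obtain s where "s \<in> I" "u = t s"
      using u J(5) by auto
    then have "\<beta> u = \<gamma> s"
      using J(6) by simp
    then show ?thesis
      using VV by (simp add: \<gamma>_def inner_diff_left)
  qed
  then have "cylinder_base J \<beta> V"
    using J unfolding cylinder_base_def by blast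
  moreover have "\<alpha> s = cylinder_param \<beta> V (t s) (\<alpha> s \<bullet> V)" if "s \<in> I" for s
    using J(6)[OF that] by (simp add: cylinder_param_def \<gamma>_def)
       (metis diff_add_cancel)
  then have "contained_in_cylinder I \<alpha> J \<beta> V"
    unfolding contained_in_cylinder_def using J(4,5) smooth_z by blast
  ultimately show ?thesis
    by (rule that)
qed

text \<open>
  This identity translates the orthogonality of \<open>W\<close> and \<open>V\<close> into the equation on the angles.
\<close>

lemma F_constant_inner_axis:
  assumes "angle_functions I \<alpha> V \<phi> \<theta>" "s \<in> I" "cos (\<phi> s) \<noteq> 0"
  shows "(a *\<^sub>R T s + b *\<^sub>R N s + c *\<^sub>R B s) \<bullet> V
    = cos (\<phi> s) * (a * tan (\<phi> s) + b * sin (\<theta> s) - c * cos (\<theta> s))"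
proof -
  let ?V = "sin (\<phi> s) *\<^sub>R T s + cos (\<phi> s) *\<^sub>R (sin (\<theta> s) *\<^sub>R N s - cos (\<theta> s) *\<^sub>R B s)"
  have "V = ?V"
    using assms(1,2) unfolding angle_functions_def by blast
  then have "(a *\<^sub>R T s + b *\<^sub>R N s + c *\<^sub>R B s) \<bullet> V = (a *\<^sub>R T s + b *\<^sub>R N s + c *\<^sub>R B s) \<bullet> ?V"
    by simp
  also have "\<dots> = a * sin (\<phi> s) + cos (\<phi> s) * (b * sin (\<theta> s) - c * cos (\<theta> s))"
    by (simp add: inner_add_left inner_add_right inner_diff_right frame_inner[OF assms(2)]
        right_diff_distrib)
  also have "\<dots> = cos (\<phi> s) * (a * tan (\<phi> s) + b * sin (\<theta> s) - c * cos (\<theta> s))"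
    using assms(3) by (simp add: tan_def field_simps)
  finally show ?thesis .
qed

end

theorem theorem5p2:
  fixes I :: "real set" and \<alpha> :: "real \<Rightarrow> real^3" and a b c :: real and V :: "real^3"
    and W :: "real \<Rightarrow> real^3"
  assumes "open I" and "is_interval I"
    and "unit_speed_curve I \<alpha>"
    and "\<forall>s\<in>I. curvature \<alpha> s > 0"
    and "\<not> coplanar (\<alpha> ` I)"
    and "a\<^sup>2 + b\<^sup>2 + c\<^sup>2 = 1"
    and "norm V = 1"
  defines "W \<equiv> \<lambda>s. a *\<^sub>R tangent \<alpha> s + b *\<^sub>R principal_normal \<alpha> s + c *\<^sub>R binormal \<alpha> s"
  shows "(helix_associated I \<alpha> W V \<and> (\<forall>s\<in>I. W s \<bullet> V = 0)) \<longleftrightarrow>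
    (\<exists>J \<beta>. cylinder_base J \<beta> V \<and> contained_in_cylinder I \<alpha> J \<beta> V) \<and>
    (\<exists>\<phi> \<theta>. angle_functions I \<alpha> V \<phi> \<theta> \<and>
       (\<forall>s\<in>I. cos (\<phi> s) \<noteq> 0 \<and>
          a * tan (\<phi> s) + b * sin (\<theta> s) - c * cos (\<theta> s) = 0))"
    (is "?helix \<longleftrightarrow> ?cylinder \<and> ?angles")
proof -
  interpret frenet_curve I \<alpha>
    using assms(1,3,4) by unfold_locales auto
  show ?thesis
  proof
    assume ?helix
    then have "\<bar>tangent \<alpha> s \<bullet> V\<bar> < 1" if "s \<in> I" for s
      using axis_nowhere_tangent[OF assms(2,5,7,6) _ that]
      by (simp add: W_def inner_add_left)
    note transversal = this
    obtain J \<beta> where cyl: "cylinder_base J \<beta> V" "contained_in_cylinder I \<alpha> J \<beta> V"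
      using contained_in_cylinder_if_nowhere_tangent[OF assms(2,7) transversal] by blast
    obtain \<phi> \<theta> where ang: "angle_functions I \<alpha> V \<phi> \<theta>" "\<And>s. s \<in> I \<Longrightarrow> cos (\<phi> s) \<noteq> 0"
      using angle_functions_exist[OF assms(2,7) transversal] by blast
    have "a * tan (\<phi> s) + b * sin (\<theta> s) - c * cos (\<theta> s) = 0" if s: "s \<in> I" for s
      using F_constant_inner_axis[OF ang(1) s ang(2)[OF s], of a b c] ang(2)[OF s] \<open>?helix\<close> s
      by (simp add: W_def)
    then show "?cylinder \<and> ?angles"
      using cyl ang by blast
  next
    assume "?cylinder \<and> ?angles"
    then obtain \<phi> \<theta> where ang: "angle_functions I \<alpha> V \<phi> \<theta>"
      "\<And>s. s \<in> I \<Longrightarrow> cos (\<phi> s) \<noteq> 0"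
      "\<And>s. s \<in> I \<Longrightarrow> a * tan (\<phi> s) + b * sin (\<theta> s) - c * cos (\<theta> s) = 0"
      by blast
    have orth: "W s \<bullet> V = 0" if "s \<in> I" for s
      unfolding W_def using F_constant_inner_axis[OF ang(1) that ang(2)[OF that]] ang(3)[OF that]
      by simp
    have "W s \<bullet> W s = 1" if "s \<in> I" for s
      using assms(6) frame_inner[OF that]
      by (simp add: W_def inner_add_left inner_add_right power2_eq_square)
    then have "W s \<noteq> 0" if "s \<in> I" for s
      using that by force
    moreover have "F_constant I \<alpha> W"
      unfolding W_def by (rule constant_coefficients_F_constant)
    moreover have "vec_angle (W s) V = pi / 2" if "s \<in> I" for s
      using orth[OF that] by (simp add: vec_angle_def)
    moreover have "V \<noteq> 0"
      using assms(7) by auto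
    ultimately show ?helix
      unfolding helix_associated_def using orth by blast
  qed
qed

end
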